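(* For every formula $\varphi$ built from propositional variables and the constant $\bot$ using the binary connective $\supset$: $\varphi$ is a theorem of Łukasiewicz infinite-valued logic $\mathbf{Ł}$ if and only if $\varphi$ belongs to the material fragment $\mathbf{A_M}$ of abelian logic, i.e. iff $\varphi$, read as a formula of abelian logic with $\bot$ treated as an ordinary propositional variable and $A \supset B$ read as $(t \land A) \to (\bot \lor B)$, is a theorem of abelian logic $\mathbf{A}$. In short, $\mathbf{Ł} = \mathbf{A_M}$.
   Context: Łukasiewicz infinite-valued logic $\mathbf{Ł}$ is the set of theorems of the Hilbert system with primitives $\supset$ and $\bot$, rule modus ponens (from $A \supset B$ and $A$ infer $B$) and axioms: (Ł1) $A \supset (B \supset A)$; (Ł2) $(A \supset B) \supset ((B \supset C) \supset (A \supset C))$; (Ł3) $((A \supset B) \supset B) \supset ((B \supset A) \supset A)$; (Ł4) $((A \supset \bot) \supset (B \supset \bot)) \supset (B \supset A)$. Equivalently (Chang), these are the formulas taking value $1$ under every valuation into $[0,1]$ with $v(\bot)=0$ and $v(A\supset B)=\min(1,1+v(B)-v(A))$. Formulas of abelian logic $\mathbf{A}$ are built from propositional variables and the constant $t$ using $+,\to,\land,\lor$. An abelian l-group is a lattice-ordered abelian group $\langle G,+,\lor,\lnot,t\rangle$ with identity $t$ and inverse $\lnot$; $a\land b=\lnot(\lnot a\lor\lnot b)$ and $a\to b=\lnot a+b$. A formula is a theorem of $\mathbf{A}$ iff $v(\varphi)\ge t$ for every valuation $v$ (homomorphic interpretation) into every abelian l-group; equivalently (Meyer–Slaney's axiomatisation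 is complete for this semantics) iff $v(\varphi)\ge 0$ for every valuation into $\langle\mathbb{Q},+,\max,-,0\rangle$. $\mathbf{A}$ has no falsity constant, so $\bot$ is treated as a propositional variable. The material fragment $\mathbf{A_M}$ is the set of theorems of $\mathbf{A}$ in the language built from propositional variables, $\bot$ and $\supset$, where $A\supset B := (t\land A)\to(\bot\lor B)$. *)

theory Defs
  imports "HOL-Algebra.Group"
begin

datatype mform =
    Prop nat
  | Bot
  | Imp mform mform  (infixr "\<^bold>\<supset>" 65)

inductive luk :: "mform \<Rightarrow> bool" where
  L1: "luk (A \<^bold>\<supset> (B \<^bold>\<supset> A))"
| L2: "luk ((A \<^bold>\<supset> B) \<^bold>\<supset> ((B \<^bold>\<supset> C) \<^bold>\<supset> (A \<^bold>\<supset> C)))"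
| L3: "luk (((A \<^bold>\<supset> B) \<^bold>\<supset> B) \<^bold>\<supset> ((B \<^bold>\<supset> A) \<^bold>\<supset> A))"
| L4: "luk (((A \<^bold>\<supset> Bot) \<^bold>\<supset> (B \<^bold>\<supset> Bot)) \<^bold>\<supset> (B \<^bold>\<supset> A))"
| MP: "luk (A \<^bold>\<supset> B) \<Longrightarrow> luk A \<Longrightarrow> luk B"

definition Luk :: "mform set" where
  "Luk = {\<phi>. luk \<phi>}"

text \<open>
  The group operation is written multiplicatively, as in HOL-Algebra: \<open>\<otimes>\<close>, \<open>inv\<close> and \<open>\<one>\<close>
  are the +, \<open>\<not>\<close> and t of abelian logic.  The order is the one induced by the join,
  and distributivity of the group operation over joins says that it is translation invariant.
\<close>

record 'g lgroup = "'g monoid" +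
  ljoin :: "'g \<Rightarrow> 'g \<Rightarrow> 'g"  (infixl "\<curlyvee>\<index>" 65)

definition lmeet :: "('g, 'm) lgroup_scheme \<Rightarrow> 'g \<Rightarrow> 'g \<Rightarrow> 'g"  (infixl "\<curlywedge>\<index>" 70) where
  "x \<curlywedge>\<^bsub>G\<^esub> y = inv\<^bsub>G\<^esub> (inv\<^bsub>G\<^esub> x \<curlyvee>\<^bsub>G\<^esub> inv\<^bsub>G\<^esub> y)"

definition lle :: "('g, 'm) lgroup_scheme \<Rightarrow> 'g \<Rightarrow> 'g \<Rightarrow> bool"  (infix "\<preceq>\<index>" 50) where
  "x \<preceq>\<^bsub>G\<^esub> y \<longleftrightarrow> x \<curlyvee>\<^bsub>G\<^esub> y = y"

locale abelian_lgroup = comm_group G for G :: "('g, 'm) lgroup_scheme" (structure) +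
  assumes join_closed [simp, intro]:
      "\<lbrakk>x \<in> carrier G; y \<in> carrier G\<rbrakk> \<Longrightarrow> x \<curlyvee> y \<in> carrier G"
    and join_assoc:
      "\<lbrakk>x \<in> carrier G; y \<in> carrier G; z \<in> carrier G\<rbrakk> \<Longrightarrow> (x \<curlyvee> y) \<curlyvee> z = x \<curlyvee> (y \<curlyvee> z)"
    and join_comm:
      "\<lbrakk>x \<in> carrier G; y \<in> carrier G\<rbrakk> \<Longrightarrow> x \<curlyvee> y = y \<curlyvee> x"
    and join_idem:
      "x \<in> carrier G \<Longrightarrow> x \<curlyvee> x = x"
    and mult_join_distrib:
      "\<lbrakk>x \<in> carrier G; y \<in> carrier G; z \<in> carrier G\<rbrakk>
        \<Longrightarrow> x \<otimes> (y \<curlyvee> z) = (x \<otimes> y) \<curlyvee> (x \<otimes> z)"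
begin

lemma lle_refl: "x \<in> carrier G \<Longrightarrow> x \<preceq> x"
  by (simp add: lle_def join_idem)

lemma lle_antisym:
  "\<lbrakk>x \<in> carrier G; y \<in> carrier G; x \<preceq> y; y \<preceq> x\<rbrakk> \<Longrightarrow> x = y"
  by (metis lle_def join_comm)

lemma lle_trans:
  "\<lbrakk>x \<in> carrier G; y \<in> carrier G; z \<in> carrier G; x \<preceq> y; y \<preceq> z\<rbrakk> \<Longrightarrow> x \<preceq> z"
  by (metis lle_def join_assoc)

lemma join_lle_iff:
  "\<lbrakk>x \<in> carrier G; y \<in> carrier G; z \<in> carrier G\<rbrakk>
    \<Longrightarrow> x \<curlyvee> y \<preceq> z \<longleftrightarrow> x \<preceq> z \<and> y \<preceq> z"
  unfolding lle_def by (metis join_assoc join_comm join_idem join_closed)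

lemma mult_lle_mono:
  assumes "x \<in> carrier G" "y \<in> carrier G" "z \<in> carrier G" "x \<preceq> y"
  shows "z \<otimes> x \<preceq> z \<otimes> y"
  using assms by (metis lle_def mult_join_distrib)

lemma inv_lle_iff:
  assumes "x \<in> carrier G" "y \<in> carrier G"
  shows "inv x \<preceq> inv y \<longleftrightarrow> y \<preceq> x"
proof -
  have *: "inv b \<preceq> inv a" if "a \<in> carrier G" "b \<in> carrier G" "a \<preceq> b" for a b
  proof -
    have "(inv a \<otimes> inv b) \<otimes> a \<preceq> (inv a \<otimes> inv b) \<otimes> b"
      using that by (intro mult_lle_mono) auto
    moreover have "(inv a \<otimes> inv b) \<otimes> a = inv b"
      using that by (metis inv_closed l_inv m_assoc m_comm r_one)
    moreover have "(inv a \<otimes> inv b) \<otimes> b = inv a"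
      using that by (simp add: m_assoc)
    ultimately show ?thesis by simp
  qed
  show ?thesis
    using *[of y x] *[of "inv x" "inv y"] assms by auto
qed

lemma lle_lmeet_iff:
  assumes "x \<in> carrier G" "y \<in> carrier G" "z \<in> carrier G"
  shows "z \<preceq> x \<curlywedge> y \<longleftrightarrow> z \<preceq> x \<and> z \<preceq> y"
  using assms inv_lle_iff[of "inv z" "inv x \<curlyvee> inv y"]
  by (simp add: lmeet_def join_lle_iff inv_lle_iff)

end

datatype 'p aform =
    AVar 'p
  | AT
  | APlus "'p aform" "'p aform"
  | AImp "'p aform" "'p aform"
  | AAnd "'p aform" "'p aform"
  | AOr "'p aform" "'p aform"

primrec aeval :: "('g, 'm) lgroup_scheme \<Rightarrow> ('p \<Rightarrow> 'g) \<Rightarrow> 'p aform \<Rightarrow> 'g" where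
  "aeval G v (AVar p) = v p"
| "aeval G v AT = \<one>\<^bsub>G\<^esub>"
| "aeval G v (APlus A B) = aeval G v A \<otimes>\<^bsub>G\<^esub> aeval G v B"
| "aeval G v (AImp A B) = inv\<^bsub>G\<^esub> (aeval G v A) \<otimes>\<^bsub>G\<^esub> aeval G v B"
| "aeval G v (AAnd A B) = aeval G v A \<curlywedge>\<^bsub>G\<^esub> aeval G v B"
| "aeval G v (AOr A B) = aeval G v A \<curlyvee>\<^bsub>G\<^esub> aeval G v B"

text \<open>
  HOL cannot quantify over all types inside a formula, so the l-groups range over all
  carrier sets \<open>\<subseteq> 'g\<close>, for a type parameter \<open>'g\<close> which is left arbitrary (but infinite)
  wherever the notion is used.
\<close>

definition abelian_theorems :: "'g itself \<Rightarrow> 'p aform set" where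
  "abelian_theorems (_ :: 'g itself) =
    {\<phi>. \<forall>(G :: 'g lgroup) v. abelian_lgroup G \<longrightarrow> range v \<subseteq> carrier G \<longrightarrow> \<one>\<^bsub>G\<^esub> \<preceq>\<^bsub>G\<^esub> aeval G v \<phi>}"

text \<open>\<open>AVar None\<close> is the propositional variable that plays the role of \<open>\<bottom>\<close>.\<close>

primrec material :: "mform \<Rightarrow> nat option aform" where
  "material (Prop n) = AVar (Some n)"
| "material Bot = AVar None"
| "material (A \<^bold>\<supset> B) = AImp (AAnd AT (material A)) (AOr (AVar None) (material B))"

definition material_fragment :: "'g itself \<Rightarrow> mform set" where
  "material_fragment T = {\<phi>. material \<phi> \<in> abelian_theorems T}"

end

theory Submission
  imports Defs "HOL-Library.Countable"
begin

text \<open>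
  Soundness is an induction on derivations in an arbitrary abelian l-group: there
  \<open>(A \<supset> B) \<supset> B\<close> has the value \<open>\<bottom> \<or> B \<or> (t \<and> A)\<close>, which makes the axioms instances of
  distributivity, and modus ponens is sound because a derivable formula is never atomic.

  Conversely, the Lindenbaum algebra of Lukasiewicz logic is a Wajsberg (MV-) algebra.  A filter that
  is maximal among those omitting the class of an underivable formula is prime, so the quotient by
  it is a chain in which the formula is refuted.  Chang's construction glues \<open>\<int>\<close> many copies of
  this chain to a countable ordered abelian group in which the chain is the interval
  \<open>[\<bottom>, 0]\<close> with \<open>\<bottom> < 0\<close>, and a countable l-group embeds into any infinite type.
\<close>

section \<open>Soundness\<close>

context abelian_lgroup
begin

lemma lmeet_closed [simp, intro]:
  "\<lbrakk>x \<in> carrier G; y \<in> carrier G\<rbrakk> \<Longrightarrow> x \<curlywedge> y \<in> carrier G"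
  by (simp add: lmeet_def)

lemma lmeet_lle:
  assumes "x \<in> carrier G" "y \<in> carrier G"
  shows "x \<curlywedge> y \<preceq> x" "x \<curlywedge> y \<preceq> y"
  using assms lle_lmeet_iff[of x y "x \<curlywedge> y"] lle_refl by auto

lemma lle_join:
  assumes "x \<in> carrier G" "y \<in> carrier G"
  shows "x \<preceq> x \<curlyvee> y" "y \<preceq> x \<curlyvee> y"
  using assms join_lle_iff[of x y "x \<curlyvee> y"] lle_refl by auto

lemma lle_inv_mult_iff:
  assumes "x \<in> carrier G" "y \<in> carrier G" "z \<in> carrier G"
  shows "z \<preceq> inv x \<otimes> y \<longleftrightarrow> x \<otimes> z \<preceq> y"
proof -
  have "inv x \<otimes> (x \<otimes> z) = z" "x \<otimes> (inv x \<otimes> y) = y"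
    using assms by (simp_all flip: m_assoc)
  then show ?thesis
    using assms mult_lle_mono[of z "inv x \<otimes> y" x] mult_lle_mono[of "x \<otimes> z" y "inv x"]
    by (metis inv_closed m_closed)
qed

text \<open>Lattice distributivity comes from the group structure. With \<open>j\<close> the join
  and \<open>z\<close> the right-hand side, translation by \<open>inv j \<otimes> m\<close> moves
  both \<open>x\<close> and \<open>y\<close> below \<open>z\<close>. Hence it moves their join
  \<open>j\<close> below \<open>z\<close> too, and the translate of \<open>j\<close> is exactly
  \<open>m\<close>.\<close>

lemma lmeet_join_lle:
  assumes c: "c \<in> carrier G" and x: "x \<in> carrier G" and y: "y \<in> carrier G"
  shows "c \<curlywedge> (x \<curlyvee> y) \<preceq> (c \<curlywedge> x) \<curlyvee> (c \<curlywedge> y)"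
proof -
  define j where "j = x \<curlyvee> y"
  define m where "m = c \<curlywedge> j"
  define z where "z = (c \<curlywedge> x) \<curlyvee> (c \<curlywedge> y)"
  have cl: "j \<in> carrier G" "m \<in> carrier G" "z \<in> carrier G"
    using assms by (auto simp: j_def m_def z_def)
  \<comment> \<open>\<open>w - j + m\<close> lies below \<open>w\<close> because \<open>m \<le> j\<close>, and below \<open>c\<close> because \<open>w \<le> j\<close>.\<close>
  have *: "w \<preceq> inv m \<otimes> (j \<otimes> z)"
    if w: "w \<in> carrier G" and wj: "w \<preceq> j" and wz: "c \<curlywedge> w \<preceq> z" for w
  proof -
    have "(inv j \<otimes> m) \<otimes> w \<preceq> w"
    proof -
      have "inv j \<otimes> m \<preceq> \<one>"
        using mult_lle_mono[of m j "inv j"] lmeet_lle[of c j] c cl by (simp add: m_def)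
      then show ?thesis
        using mult_lle_mono[of "inv j \<otimes> m" \<one> w] w cl by (simp add: m_comm)
    qed
    moreover have "(inv j \<otimes> m) \<otimes> w \<preceq> c"
    proof -
      have "inv j \<otimes> w \<preceq> \<one>"
        using mult_lle_mono[of w j "inv j"] wj w cl by simp
      then have "m \<otimes> (inv j \<otimes> w) \<preceq> m"
        using mult_lle_mono[of "inv j \<otimes> w" \<one> m] w cl by simp
      moreover have "m \<preceq> c"
        using lmeet_lle[of c j] c cl by (simp add: m_def)
      ultimately have "m \<otimes> (inv j \<otimes> w) \<preceq> c"
        using lle_trans[of "m \<otimes> (inv j \<otimes> w)" m c] c w cl by simp
      moreover have "m \<otimes> (inv j \<otimes> w) = (inv j \<otimes> m) \<otimes> w"
        using w cl by (simp add: m_ac)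
      ultimately show ?thesis by simp
    qed
    ultimately have "(inv j \<otimes> m) \<otimes> w \<preceq> z"
      using lle_lmeet_iff[of c w "(inv j \<otimes> m) \<otimes> w"] wz
        lle_trans[of "(inv j \<otimes> m) \<otimes> w" "c \<curlywedge> w" z] c w cl by simp
    then have "inv j \<otimes> (m \<otimes> w) \<preceq> z"
      using w cl by (simp add: m_assoc)
    then have "m \<otimes> w \<preceq> j \<otimes> z"
      using lle_inv_mult_iff[of "inv j" z "m \<otimes> w"] mult_lle_mono[of "inv j \<otimes> (m \<otimes> w)" z j] w cl
      by (simp flip: m_assoc)
    then show ?thesis
      using lle_inv_mult_iff[of m "j \<otimes> z" w] w cl by simp
  qed
  have "j \<preceq> inv m \<otimes> (j \<otimes> z)"
    using *[of x] *[of y] x y c cl lle_join[of x y] lle_join[of "c \<curlywedge> x" "c \<curlywedge> y"]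
      join_lle_iff[of x y "inv m \<otimes> (j \<otimes> z)"] by (simp add: j_def z_def)
  then have "m \<otimes> j \<preceq> j \<otimes> z"
    using lle_inv_mult_iff[of m "j \<otimes> z" j] cl by simp
  then have "inv j \<otimes> (m \<otimes> j) \<preceq> inv j \<otimes> (j \<otimes> z)"
    using mult_lle_mono[of "m \<otimes> j" "j \<otimes> z" "inv j"] cl by simp
  moreover have "inv j \<otimes> (m \<otimes> j) = m" "inv j \<otimes> (j \<otimes> z) = z"
    using cl by (simp_all add: m_comm[of m j] flip: m_assoc)
  ultimately have "m \<preceq> z" by simp
  then show ?thesis by (simp add: m_def z_def j_def)
qed

section \<open>The value of a material implication, where \<open>b\<close> is the value of
  \<bottom>\<close>

definition mimp :: "'g \<Rightarrow> 'g \<Rightarrow> 'g \<Rightarrow> 'g" where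
  "mimp b x y = inv (\<one> \<curlywedge> x) \<otimes> (b \<curlyvee> y)"

lemma mimp_closed [simp, intro]:
  "\<lbrakk>b \<in> carrier G; x \<in> carrier G; y \<in> carrier G\<rbrakk> \<Longrightarrow> mimp b x y \<in> carrier G"
  by (simp add: mimp_def)

lemma one_lle_mimp_iff:
  assumes "b \<in> carrier G" "x \<in> carrier G" "y \<in> carrier G"
  shows "\<one> \<preceq> mimp b x y \<longleftrightarrow> \<one> \<curlywedge> x \<preceq> b \<curlyvee> y"
  using assms lle_inv_mult_iff[of "\<one> \<curlywedge> x" "b \<curlyvee> y" \<one>] by (simp add: mimp_def)

lemma join_lle_mimp:
  assumes "b \<in> carrier G" "x \<in> carrier G" "y \<in> carrier G"
  shows "b \<curlyvee> y \<preceq> mimp b x y"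
proof -
  have "(\<one> \<curlywedge> x) \<otimes> (b \<curlyvee> y) \<preceq> \<one> \<otimes> (b \<curlyvee> y)"
    using mult_lle_mono[of "\<one> \<curlywedge> x" \<one> "b \<curlyvee> y"] lmeet_lle[of \<one> x] assms by (simp add: m_comm)
  then show ?thesis
    using lle_inv_mult_iff[of "\<one> \<curlywedge> x" "b \<curlyvee> y" "b \<curlyvee> y"] assms by (simp add: mimp_def)
qed

lemma lle_mimp:
  assumes "b \<in> carrier G" "x \<in> carrier G" "y \<in> carrier G"
  shows "b \<preceq> mimp b x y" "y \<preceq> mimp b x y"
  using assms join_lle_mimp[of b x y] join_lle_iff[of b y "mimp b x y"] by auto

text \<open>Because of this, the join with \<open>b\<close> drops out whenever the consequent is
  itself an implication.\<close>

lemma join_mimp: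
  assumes "b \<in> carrier G" "x \<in> carrier G" "y \<in> carrier G"
  shows "b \<curlyvee> mimp b x y = mimp b x y"
  using lle_mimp(1)[OF assms] by (simp add: lle_def)

text \<open>With the outer join absorbed, both sides are the product of
  \<open>inv (\<one> \<curlywedge> x)\<close>, \<open>inv (\<one> \<curlywedge> y)\<close> and
  \<open>b \<curlyvee> z\<close>.\<close>

lemma mimp_exchange:
  assumes "b \<in> carrier G" "x \<in> carrier G" "y \<in> carrier G" "z \<in> carrier G"
  shows "mimp b x (mimp b y z) = mimp b y (mimp b x z)"
proof -
  have "mimp b x (mimp b y z) = inv (\<one> \<curlywedge> x) \<otimes> mimp b y z"
    and "mimp b y (mimp b x z) = inv (\<one> \<curlywedge> y) \<otimes> mimp b x z"
    using assms join_mimp[of b y z] join_mimp[of b x z] mimp_def[of b x "mimp b y z"]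
      mimp_def[of b y "mimp b x z"] by auto
  then show ?thesis
    using assms by (simp add: mimp_def m_ac)
qed

text \<open>In additive notation, with X = 0 \<and> x and Y = b \<or> y: -(0 \<and> (Y - X)) + Y =
  (0 \<or> (X - Y)) + Y = X \<or> Y.\<close>

lemma mimp_mimp:
  assumes "b \<in> carrier G" "x \<in> carrier G" "y \<in> carrier G"
  shows "mimp b (mimp b x y) y = (b \<curlyvee> y) \<curlyvee> (\<one> \<curlywedge> x)"
proof -
  let ?X = "\<one> \<curlywedge> x" and ?Y = "b \<curlyvee> y"
  have cl: "?X \<in> carrier G" "?Y \<in> carrier G" using assms by auto
  have "mimp b (mimp b x y) y = inv (\<one> \<curlywedge> (inv ?X \<otimes> ?Y)) \<otimes> ?Y"
    by (simp add: mimp_def)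
  also have "\<dots> = (\<one> \<curlyvee> inv (inv ?X \<otimes> ?Y)) \<otimes> ?Y"
    using cl by (simp add: lmeet_def[of G \<one> "inv ?X \<otimes> ?Y"])
  also have "\<dots> = ?Y \<otimes> (\<one> \<curlyvee> (?X \<otimes> inv ?Y))"
    using cl by (simp add: inv_mult m_comm)
  also have "\<dots> = ?Y \<curlyvee> ?X"
    using cl by (simp add: mult_join_distrib m_lcomm[of ?Y ?X])
  finally show ?thesis .
qed

lemma mimp_mono:
  assumes "b \<in> carrier G" "x \<in> carrier G" "y \<in> carrier G" "z \<in> carrier G"
    and "b \<curlyvee> y \<preceq> b \<curlyvee> z"
  shows "mimp b x y \<preceq> mimp b x z"
  using assms mult_lle_mono[of "b \<curlyvee> y" "b \<curlyvee> z" "inv (\<one> \<curlywedge> x)"] by (simp add: mimp_def)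

lemma one_lle_mimpI:
  assumes "b \<in> carrier G" "x \<in> carrier G" "y \<in> carrier G" "\<one> \<curlywedge> x \<preceq> y"
  shows "\<one> \<preceq> mimp b x y"
  using assms lle_join[of b y] lle_trans[of "\<one> \<curlywedge> x" y "b \<curlyvee> y"]
  by (simp add: one_lle_mimp_iff)

lemma mimp_L1:
  assumes "b \<in> carrier G" "x \<in> carrier G" "y \<in> carrier G"
  shows "\<one> \<preceq> mimp b x (mimp b y x)"
  using assms lmeet_lle[of \<one> x] lle_mimp[of b y x] lle_trans[of "\<one> \<curlywedge> x" x "mimp b y x"]
  by (intro one_lle_mimpI) auto

text \<open>The estimate shared by L2 and L3: distribute the meet, then absorb
  \<open>\<one> \<curlywedge> b\<close> into \<open>b\<close>.\<close>

lemma one_lmeet_join_lle: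
  assumes "b \<in> carrier G" "x \<in> carrier G" "y \<in> carrier G"
  shows "\<one> \<curlywedge> (b \<curlyvee> y) \<preceq> (b \<curlyvee> x) \<curlyvee> (\<one> \<curlywedge> y)"
proof -
  let ?r = "(b \<curlyvee> x) \<curlyvee> (\<one> \<curlywedge> y)"
  have "\<one> \<curlywedge> b \<preceq> b" "b \<preceq> b \<curlyvee> x" "b \<curlyvee> x \<preceq> ?r" "\<one> \<curlywedge> y \<preceq> ?r"
    using assms by (auto simp: lmeet_lle lle_join)
  then have "(\<one> \<curlywedge> b) \<curlyvee> (\<one> \<curlywedge> y) \<preceq> ?r"
    using assms lle_trans[of "\<one> \<curlywedge> b" b "b \<curlyvee> x"] lle_trans[of "\<one> \<curlywedge> b" "b \<curlyvee> x" ?r]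
    by (simp add: join_lle_iff)
  then show ?thesis
    using assms lmeet_join_lle[of \<one> b y]
      lle_trans[of "\<one> \<curlywedge> (b \<curlyvee> y)" "(\<one> \<curlywedge> b) \<curlyvee> (\<one> \<curlywedge> y)" ?r] by simp
qed

text \<open>Exchange and \<open>mimp_mimp\<close> turn the consequent into
  \<open>mimp b x ?r\<close>. By residuation it then suffices to bound
  \<open>?X \<otimes> ?m\<close>, which lies below both \<one> and
  \<open>b \<curlyvee> y\<close>.\<close>

lemma mimp_L2:
  assumes "b \<in> carrier G" "x \<in> carrier G" "y \<in> carrier G" "z \<in> carrier G"
  shows "\<one> \<preceq> mimp b (mimp b x y) (mimp b (mimp b y z) (mimp b x z))"
proof -
  let ?X = "\<one> \<curlywedge> x" and ?r = "(b \<curlyvee> z) \<curlyvee> (\<one> \<curlywedge> y)"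
  let ?m = "\<one> \<curlywedge> mimp b x y"
  have m: "?m \<preceq> \<one>" "?m \<preceq> mimp b x y"
    using assms lmeet_lle[of \<one> "mimp b x y"] by auto
  have "?X \<otimes> ?m \<preceq> ?X"
    using assms m mult_lle_mono[of ?m \<one> ?X] by simp
  then have "?X \<otimes> ?m \<preceq> \<one>"
    using assms lmeet_lle[of \<one> x] lle_trans[of "?X \<otimes> ?m" ?X \<one>] by simp
  moreover have "?X \<otimes> ?m \<preceq> b \<curlyvee> y"
    using assms m lle_inv_mult_iff[of ?X "b \<curlyvee> y" ?m] by (simp add: mimp_def)
  ultimately have "?X \<otimes> ?m \<preceq> \<one> \<curlywedge> (b \<curlyvee> y)"
    using assms by (simp add: lle_lmeet_iff)
  then have "?X \<otimes> ?m \<preceq> ?r"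
    using assms one_lmeet_join_lle[of b z y] lle_trans[of "?X \<otimes> ?m" "\<one> \<curlywedge> (b \<curlyvee> y)" ?r] by simp
  then have "?X \<otimes> ?m \<preceq> b \<curlyvee> ?r"
    using assms lle_join[of b ?r] lle_trans[of "?X \<otimes> ?m" ?r "b \<curlyvee> ?r"] by simp
  then have "?m \<preceq> mimp b x ?r"
    using assms lle_inv_mult_iff[of ?X "b \<curlyvee> ?r" ?m] by (simp add: mimp_def[of b x ?r])
  then show ?thesis
    using assms mimp_exchange[of b "mimp b y z" x z] mimp_mimp[of b y z]
    by (intro one_lle_mimpI) auto
qed

lemma mimp_L3:
  assumes "b \<in> carrier G" "x \<in> carrier G" "y \<in> carrier G"
  shows "\<one> \<preceq> mimp b (mimp b (mimp b x y) y) (mimp b (mimp b y x) x)"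
proof (rule one_lle_mimpI)
  let ?r = "(b \<curlyvee> x) \<curlyvee> (\<one> \<curlywedge> y)" and ?s = "(b \<curlyvee> y) \<curlyvee> (\<one> \<curlywedge> x)"
  have x: "\<one> \<curlywedge> (\<one> \<curlywedge> x) \<preceq> ?r"
  proof -
    have "\<one> \<curlywedge> (\<one> \<curlywedge> x) \<preceq> \<one> \<curlywedge> x" "\<one> \<curlywedge> x \<preceq> x" "x \<preceq> b \<curlyvee> x" "b \<curlyvee> x \<preceq> ?r"
      using assms by (auto simp: lmeet_lle lle_join)
    then show ?thesis
      using assms by (meson lle_trans lmeet_closed join_closed one_closed)
  qed
  have "(\<one> \<curlywedge> (b \<curlyvee> y)) \<curlyvee> (\<one> \<curlywedge> (\<one> \<curlywedge> x)) \<preceq> ?r"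
    using assms x one_lmeet_join_lle[of b x y] by (simp add: join_lle_iff)
  then have "\<one> \<curlywedge> ?s \<preceq> ?r"
    using assms lmeet_join_lle[of \<one> "b \<curlyvee> y" "\<one> \<curlywedge> x"]
      lle_trans[of "\<one> \<curlywedge> ?s" "(\<one> \<curlywedge> (b \<curlyvee> y)) \<curlyvee> (\<one> \<curlywedge> (\<one> \<curlywedge> x))" ?r] by simp
  then show "\<one> \<curlywedge> mimp b (mimp b x y) y \<preceq> mimp b (mimp b y x) x"
    using assms by (simp add: mimp_mimp)
qed (use assms in auto)

text \<open>Exchange and \<open>mimp_mimp\<close> rewrite the antecedent as
  \<open>mimp b y ?v\<close>, where the double negation \<open>?v\<close> of \<open>x\<close> lies
  below \<open>b \<curlyvee> x\<close>; monotonicity finishes.\<close>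

lemma mimp_L4:
  assumes "b \<in> carrier G" "x \<in> carrier G" "y \<in> carrier G"
  shows "\<one> \<preceq> mimp b (mimp b (mimp b x b) (mimp b y b)) (mimp b y x)"
proof (rule one_lle_mimpI)
  let ?v = "b \<curlyvee> (\<one> \<curlywedge> x)" and ?l = "mimp b (mimp b x b) (mimp b y b)"
  have l: "?l = mimp b y ?v"
    using assms mimp_exchange[of b "mimp b x b" y b] mimp_mimp[of b x b] by (simp add: join_idem)
  have "\<one> \<curlywedge> x \<preceq> b \<curlyvee> x"
    using assms lmeet_lle[of \<one> x] lle_join[of b x] lle_trans[of "\<one> \<curlywedge> x" x "b \<curlyvee> x"] by simp
  then have "b \<curlyvee> ?v \<preceq> b \<curlyvee> x"
    using assms lle_join[of b x] by (simp add: join_lle_iff)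
  then have "?l \<preceq> mimp b y x"
    using assms mimp_mono[of b y ?v x] l by simp
  then show "\<one> \<curlywedge> ?l \<preceq> mimp b y x"
    using assms lmeet_lle[of \<one> ?l] lle_trans[of "\<one> \<curlywedge> ?l" ?l "mimp b y x"] by simp
qed (use assms in auto)

section \<open>Soundness of derivations\<close>

lemma aeval_material_closed:
  assumes "range v \<subseteq> carrier G"
  shows "aeval G v (material A) \<in> carrier G"
proof -
  have "v p \<in> carrier G" for p
    using assms by blast
  then show ?thesis
    by (induction A) simp_all
qed

lemma aeval_material_Imp:
  "aeval G v (material (A \<^bold>\<supset> B)) =
    mimp (v None) (aeval G v (material A)) (aeval G v (material B))"
  by (simp add: mimp_def)

end

text \<open>The classical valuation that falsifies every variable and \<bottom> verifies every
  derivable formula, so no atom is derivable. This also yields consistency.\<close>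

lemma luk_compound:
  assumes "luk A"
  obtains B C where "A = B \<^bold>\<supset> C"
proof -
  define ev where "ev = rec_mform (\<lambda>_. False) False (\<lambda>_ _ a b. a \<longrightarrow> b)"
  have [simp]: "ev (Prop n) = False" "ev Bot = False" "ev (B \<^bold>\<supset> C) = (ev B \<longrightarrow> ev C)" for n B C
    by (simp_all add: ev_def)
  from assms have "ev A"
    by induction auto
  then show ?thesis
    using that by (cases A) auto
qed

theorem (in abelian_lgroup) luk_sound:
  assumes v: "range v \<subseteq> carrier G" and "luk A"
  shows "\<one> \<preceq> aeval G v (material A)"
  using \<open>luk A\<close>
proof induction
  case (MP A B)
  let ?b = "v None" and ?x = "aeval G v (material A)" and ?y = "aeval G v (material B)"
  have cl: "?b \<in> carrier G" "?x \<in> carrier G" "?y \<in> carrier G"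
    using v aeval_material_closed[OF v] by auto
  have "luk B"
    using MP.hyps by (rule luk.MP)
  \<comment> \<open>\<open>\<bottom>\<close> need not lie below \<open>t\<close>, but it lies below every compound formula.\<close>
  then obtain C D where "B = C \<^bold>\<supset> D"
    by (rule luk_compound)
  then have "?b \<curlyvee> ?y = ?y"
    using cl v aeval_material_closed[OF v] by (simp only: aeval_material_Imp join_mimp)
  moreover have "\<one> \<curlywedge> ?x \<preceq> ?b \<curlyvee> ?y"
    using MP.IH(1) cl by (simp only: aeval_material_Imp one_lle_mimp_iff)
  moreover have "\<one> \<preceq> \<one> \<curlywedge> ?x"
    using MP.IH(2) cl by (simp add: lle_lmeet_iff lle_refl)
  ultimately show ?case
    using cl lle_trans[of \<one> "\<one> \<curlywedge> ?x" ?y] by simp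
next
  case (L1 A B)
  then show ?case
    unfolding aeval_material_Imp using v aeval_material_closed[OF v] by (intro mimp_L1) auto
next
  case (L2 A B C)
  then show ?case
    unfolding aeval_material_Imp using v aeval_material_closed[OF v] by (intro mimp_L2) auto
next
  case (L3 A B)
  then show ?case
    unfolding aeval_material_Imp using v aeval_material_closed[OF v] by (intro mimp_L3) auto
next
  case (L4 A B)
  \<comment> \<open>In L4 the constant \<bottom> occurs as a subformula; its value is the same
    \<open>b\<close> that is built into \<open>mimp\<close>.\<close>
  have "aeval G v (material Bot) = v None" by simp
  then show ?case
    unfolding aeval_material_Imp using v aeval_material_closed[OF v]
    by (simp only: mimp_L4 range_subsetD)
qed

section \<open>Wajsberg algebras\<close>

text \<open>The implicational presentation of MV-algebras. A type class allows the quotients below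
  to be instances and the Chang group to be a type constructor.\<close>

class wajsberg = zero + one +
  fixes wimp :: "'a \<Rightarrow> 'a \<Rightarrow> 'a"  (infixr "\<rightharpoonup>" 60)
  assumes one_wimp [simp]: "1 \<rightharpoonup> x = x"
    and wimp_trans_one: "(x \<rightharpoonup> y) \<rightharpoonup> ((y \<rightharpoonup> z) \<rightharpoonup> (x \<rightharpoonup> z)) = 1"
    and wimp_wimp_comm: "(x \<rightharpoonup> y) \<rightharpoonup> y = (y \<rightharpoonup> x) \<rightharpoonup> x"
    and wimp_contrapos_one: "((x \<rightharpoonup> 0) \<rightharpoonup> (y \<rightharpoonup> 0)) \<rightharpoonup> (y \<rightharpoonup> x) = 1"
begin

definition wle :: "'a \<Rightarrow> 'a \<Rightarrow> bool"  (infix "\<lesssim>" 50) where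
  "x \<lesssim> y \<longleftrightarrow> x \<rightharpoonup> y = 1"

definition wneg :: "'a \<Rightarrow> 'a"  ("\<sim>_" [80] 80) where
  "\<sim>x = x \<rightharpoonup> 0"

definition wjoin :: "'a \<Rightarrow> 'a \<Rightarrow> 'a"  (infixl "\<Or>" 65) where
  "x \<Or> y = (x \<rightharpoonup> y) \<rightharpoonup> y"

text \<open>Strong disjunction and, next, strong conjunction: on [0,1] they are min(1, x + y) and
  max(0, x + y - 1).\<close>

definition wplus :: "'a \<Rightarrow> 'a \<Rightarrow> 'a"  (infixl "\<boxplus>" 65) where
  "x \<boxplus> y = \<sim>x \<rightharpoonup> y"

definition wtimes :: "'a \<Rightarrow> 'a \<Rightarrow> 'a"  (infixl "\<boxdot>" 70) where
  "x \<boxdot> y = \<sim>(x \<rightharpoonup> \<sim>y)"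

section \<open>Order, exchange, negation and prelinearity\<close>

lemma wimp_refl [simp]: "x \<rightharpoonup> x = 1"
  by (metis one_wimp wimp_trans_one)

lemma wle_refl [simp]: "x \<lesssim> x"
  by (simp add: wle_def)

lemma wle_antisym: "x \<lesssim> y \<Longrightarrow> y \<lesssim> x \<Longrightarrow> x = y"
  by (metis wle_def one_wimp wimp_wimp_comm)

lemma wle_trans: "x \<lesssim> y \<Longrightarrow> y \<lesssim> z \<Longrightarrow> x \<lesssim> z"
  by (metis wle_def one_wimp wimp_trans_one)

lemma wimp_one [simp]: "x \<rightharpoonup> 1 = 1"
  by (metis one_wimp wimp_refl wimp_trans_one wimp_wimp_comm)

lemma wle_one [simp]: "x \<lesssim> 1"
  by (simp add: wle_def)

lemma one_wle_iff [simp]: "1 \<lesssim> x \<longleftrightarrow> x = 1"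
  by (simp add: wle_def)

lemma wle_wimp: "x \<lesssim> y \<rightharpoonup> x"
  by (metis one_wimp wimp_one wimp_trans_one wle_def)

lemma wimp_antimono: "x \<lesssim> y \<Longrightarrow> y \<rightharpoonup> z \<lesssim> x \<rightharpoonup> z"
  by (metis one_wimp wimp_trans_one wle_def)

lemma wle_wjoin: "x \<lesssim> x \<Or> y" "y \<lesssim> x \<Or> y"
  by (metis wjoin_def wimp_wimp_comm wle_wimp)+

lemma wjoin_comm: "x \<Or> y = y \<Or> x"
  by (simp add: wjoin_def wimp_wimp_comm)

lemma wjoin_least: "x \<lesssim> z \<Longrightarrow> y \<lesssim> z \<Longrightarrow> x \<Or> y \<lesssim> z"
  by (metis one_wimp wimp_antimono wimp_wimp_comm wjoin_def wle_def)

lemma wimp_exchange_le: "x \<rightharpoonup> (y \<rightharpoonup> z) \<lesssim> y \<rightharpoonup> (x \<rightharpoonup> z)"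
proof -
  have "x \<rightharpoonup> (y \<rightharpoonup> z) \<lesssim> ((y \<rightharpoonup> z) \<rightharpoonup> z) \<rightharpoonup> (x \<rightharpoonup> z)"
    by (simp add: wle_def wimp_trans_one)
  moreover have "\<dots> \<lesssim> y \<rightharpoonup> (x \<rightharpoonup> z)"
    using wimp_antimono wle_wjoin(1)[of y z] by (simp add: wjoin_def)
  ultimately show ?thesis by (rule wle_trans)
qed

lemma wimp_exchange: "x \<rightharpoonup> (y \<rightharpoonup> z) = y \<rightharpoonup> (x \<rightharpoonup> z)"
  by (intro wle_antisym wimp_exchange_le)

lemma wle_wimp_swap: "x \<lesssim> y \<rightharpoonup> z \<longleftrightarrow> y \<lesssim> x \<rightharpoonup> z"
  by (simp add: wle_def wimp_exchange)

lemma wimp_mono: "x \<lesssim> y \<Longrightarrow> z \<rightharpoonup> x \<lesssim> z \<rightharpoonup> y"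
  by (metis one_wimp wimp_exchange wimp_trans_one wle_def)

lemma zero_wle [simp]: "0 \<lesssim> x"
proof -
  have "x \<rightharpoonup> 0 \<lesssim> 0 \<rightharpoonup> 0" by simp
  then show ?thesis by (metis one_wimp wimp_contrapos_one wle_def)
qed

lemma zero_wimp [simp]: "0 \<rightharpoonup> x = 1"
  using zero_wle by (simp add: wle_def)

lemma wneg_wneg [simp]: "\<sim>\<sim>x = x"
  by (metis one_wimp wimp_wimp_comm wneg_def zero_wimp)

lemma wneg_zero [simp]: "\<sim>0 = 1" and wneg_one [simp]: "\<sim>1 = 0"
  by (simp_all add: wneg_def)

lemma wimp_contrapos: "\<sim>y \<rightharpoonup> \<sim>x = x \<rightharpoonup> y"
  by (metis wneg_def wneg_wneg wimp_exchange)

lemma wneg_wle_iff [simp]: "\<sim>x \<lesssim> \<sim>y \<longleftrightarrow> y \<lesssim> x"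
  by (simp add: wle_def wimp_contrapos)

lemma wneg_eq_zero_iff [simp]: "\<sim>x = 0 \<longleftrightarrow> x = 1" and wneg_eq_one_iff [simp]: "\<sim>x = 1 \<longleftrightarrow> x = 0"
  by (metis wneg_zero wneg_one wneg_wneg)+

text \<open>Contraposition and exchange exhibit both sides as \<open>\<sim>z\<close> implying the
  join of \<open>\<sim>x\<close> and \<open>\<sim>y\<close>, which is symmetric in \<open>x\<close>
  and \<open>y\<close>.\<close>

lemma wimp_wimp_left: "(x \<rightharpoonup> y) \<rightharpoonup> (x \<rightharpoonup> z) = (y \<rightharpoonup> x) \<rightharpoonup> (y \<rightharpoonup> z)"
proof -
  have "(x \<rightharpoonup> y) \<rightharpoonup> (x \<rightharpoonup> z) = (\<sim>y \<rightharpoonup> \<sim>x) \<rightharpoonup> (\<sim>z \<rightharpoonup> \<sim>x)"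
    by (simp add: wimp_contrapos)
  also have "\<dots> = \<sim>z \<rightharpoonup> ((\<sim>y \<rightharpoonup> \<sim>x) \<rightharpoonup> \<sim>x)"
    by (rule wimp_exchange)
  also have "\<dots> = \<sim>z \<rightharpoonup> ((\<sim>x \<rightharpoonup> \<sim>y) \<rightharpoonup> \<sim>y)"
    by (simp add: wimp_wimp_comm)
  also have "\<dots> = (\<sim>x \<rightharpoonup> \<sim>y) \<rightharpoonup> (\<sim>z \<rightharpoonup> \<sim>y)"
    by (rule wimp_exchange)
  also have "\<dots> = (y \<rightharpoonup> x) \<rightharpoonup> (y \<rightharpoonup> z)"
    by (simp add: wimp_contrapos)
  finally show ?thesis .
qed

lemma wjoin_wimp_right: "(x \<Or> y) \<rightharpoonup> y = x \<rightharpoonup> y"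
proof (rule wle_antisym)
  show "(x \<Or> y) \<rightharpoonup> y \<lesssim> x \<rightharpoonup> y"
    by (intro wimp_antimono wle_wjoin)
  show "x \<rightharpoonup> y \<lesssim> (x \<Or> y) \<rightharpoonup> y"
    unfolding wjoin_def[of x y] by (subst wle_wimp_swap) simp
qed

text \<open>Applied to the join \<open>?z\<close> and \<open>y\<close>, the symmetry of
  \<open>wimp_wimp_left\<close> gives (x \<rightharpoonup> y) \<rightharpoonup> (y \<rightharpoonup>
  x) = y \<rightharpoonup> x, so the join in question unfolds to an element implying itself.\<close>

lemma prelinear: "(x \<rightharpoonup> y) \<Or> (y \<rightharpoonup> x) = 1"
proof -
  let ?z = "x \<Or> y"
  have x: "?z \<rightharpoonup> x = y \<rightharpoonup> x" and y: "?z \<rightharpoonup> y = x \<rightharpoonup> y"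
    using wjoin_wimp_right[of x y] wjoin_wimp_right[of y x] by (simp_all add: wjoin_comm)
  have "(?z \<rightharpoonup> y) \<rightharpoonup> (?z \<rightharpoonup> x) = (y \<rightharpoonup> ?z) \<rightharpoonup> (y \<rightharpoonup> x)"
    by (rule wimp_wimp_left)
  also have "y \<rightharpoonup> ?z = 1"
    using wle_wjoin(2)[of y x] by (simp add: wle_def)
  finally have "(x \<rightharpoonup> y) \<rightharpoonup> (y \<rightharpoonup> x) = y \<rightharpoonup> x"
    by (simp only: x y one_wimp)
  then show ?thesis
    by (simp add: wjoin_def[of "x \<rightharpoonup> y"])
qed

section \<open>Implicative filters and primeness\<close>

definition wfilter :: "'a set \<Rightarrow> bool" where
  "wfilter F \<longleftrightarrow> 1 \<in> F \<and> (\<forall>x y. x \<in> F \<longrightarrow> x \<rightharpoonup> y \<in> F \<longrightarrow> y \<in> F)"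

lemma wfilter_one: "wfilter F \<Longrightarrow> 1 \<in> F"
  by (simp add: wfilter_def)

lemma wfilter_mp: "wfilter F \<Longrightarrow> x \<in> F \<Longrightarrow> x \<rightharpoonup> y \<in> F \<Longrightarrow> y \<in> F"
  unfolding wfilter_def by blast

lemma wfilter_up: "wfilter F \<Longrightarrow> x \<in> F \<Longrightarrow> x \<lesssim> y \<Longrightarrow> y \<in> F"
  by (metis wfilter_def wle_def)

text \<open>Lets modus ponens act under a join with a fixed \<open>d\<close>, as
  \<open>wfilter_wjoin\<close> requires.\<close>

lemma wimp_wjoin_mono: "(z \<rightharpoonup> w) \<Or> d \<lesssim> (z \<Or> d) \<rightharpoonup> (w \<Or> d)"
proof (rule wjoin_least)
  have "z \<lesssim> (z \<rightharpoonup> w) \<rightharpoonup> (w \<Or> d)"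
    using wle_wjoin(1)[of z w] wimp_mono[OF wle_wjoin(1)[of w d]] by (metis wjoin_def wle_trans)
  moreover have "d \<lesssim> (z \<rightharpoonup> w) \<rightharpoonup> (w \<Or> d)"
    using wle_wjoin(2)[of d w] wle_wimp wle_trans by blast
  ultimately show "z \<rightharpoonup> w \<lesssim> (z \<Or> d) \<rightharpoonup> (w \<Or> d)"
    by (subst wle_wimp_swap) (rule wjoin_least)
  show "d \<lesssim> (z \<Or> d) \<rightharpoonup> (w \<Or> d)"
    using wle_wjoin(2)[of d w] wle_wimp wle_trans by blast
qed

text \<open>This enlargement of \<open>F\<close> takes the place of a generated filter in the
  maximality argument.\<close>

lemma wfilter_wjoin:
  assumes F: "wfilter F"
  shows "wfilter {z. z \<Or> d \<in> F}"
  unfolding wfilter_def mem_Collect_eq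
proof (intro conjI allI impI)
  show "1 \<Or> d \<in> F"
    using wfilter_one[OF F] by (simp add: wjoin_def)
  fix x y
  assume 1: "x \<Or> d \<in> F" and 2: "(x \<rightharpoonup> y) \<Or> d \<in> F"
  show "y \<Or> d \<in> F"
    by (rule wfilter_mp[OF F 1 wfilter_up[OF F 2 wimp_wjoin_mono]])
qed

text \<open>Primeness in the form that makes the quotient totally ordered.\<close>

definition prime_wfilter :: "'a set \<Rightarrow> bool" where
  "prime_wfilter F \<longleftrightarrow> wfilter F \<and> (\<forall>x y. x \<rightharpoonup> y \<in> F \<or> y \<rightharpoonup> x \<in> F)"

theorem prime_wfilter_exists:
  assumes "a \<noteq> 1"
  obtains F where "prime_wfilter F" "a \<notin> F"
proof -
  define \<A> where "\<A> = {F. wfilter F \<and> a \<notin> F}"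
  have "\<exists>M\<in>\<A>. \<forall>F\<in>\<A>. M \<subseteq> F \<longrightarrow> F = M"
  proof (rule subset_Zorn_nonempty)
    have "{1} \<in> \<A>"
      using assms by (auto simp: \<A>_def wfilter_def)
    then show "\<A> \<noteq> {}" by blast
  next
    fix \<C> assume "\<C> \<noteq> {}" and chain: "subset.chain \<A> \<C>"
    then have C: "\<C> \<subseteq> \<A>" and total: "\<And>F H. F \<in> \<C> \<Longrightarrow> H \<in> \<C> \<Longrightarrow> F \<subseteq> H \<or> H \<subseteq> F"
      by (auto simp: subset_chain_def)
    have "y \<in> \<Union>\<C>" if x: "x \<in> \<Union>\<C>" and xy: "x \<rightharpoonup> y \<in> \<Union>\<C>" for x y
    proof -
      obtain F H where "F \<in> \<C>" "H \<in> \<C>" "x \<in> F" "x \<rightharpoonup> y \<in> H"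
        using x xy by blast
      then obtain K where "K \<in> \<C>" "x \<in> K" "x \<rightharpoonup> y \<in> K"
        using total by blast
      moreover have "wfilter K"
        using C \<open>K \<in> \<C>\<close> by (auto simp: \<A>_def)
      ultimately show ?thesis
        using wfilter_mp by blast
    qed
    moreover have "1 \<in> \<Union>\<C>"
      using C \<open>\<C> \<noteq> {}\<close> wfilter_one by (auto simp: \<A>_def)
    ultimately have "wfilter (\<Union>\<C>)"
      unfolding wfilter_def by (intro conjI allI impI)
    then show "\<Union>\<C> \<in> \<A>"
      using C by (auto simp: \<A>_def)
  qed
  then obtain M where M: "wfilter M" "a \<notin> M"
    and max: "\<And>F. wfilter F \<Longrightarrow> a \<notin> F \<Longrightarrow> M \<subseteq> F \<Longrightarrow> F = M"
    by (auto simp: \<A>_def)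
  have sub: "M \<subseteq> {z. z \<Or> d \<in> M}" for d
    using wfilter_up[OF M(1) _ wle_wjoin(1)] by auto
  \<comment> \<open>Since \<open>u\<close> is missing from \<open>M\<close>, the enlargement by
    \<open>v\<close> is strictly larger and must contain \<open>a\<close>. So \<open>v\<close> lies
    in the enlargement by \<open>a\<close>, which omits \<open>a\<close> because
    \<open>a \<Or> a = a\<close>, and hence equals \<open>M\<close>.\<close>
  have "v \<in> M" if "u \<Or> v = 1" "u \<notin> M" for u v
  proof -
    have "u \<in> {z. z \<Or> v \<in> M}"
      using that(1) wfilter_one[OF M(1)] by simp
    then have "a \<Or> v \<in> M"
      using max[OF wfilter_wjoin[OF M(1)] _ sub, of v] that(2) by blast
    then have "v \<in> {z. z \<Or> a \<in> M}"
      by (simp add: wjoin_comm)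
    moreover have "a \<Or> a = a"
      by (simp add: wjoin_def)
    ultimately show ?thesis
      using max[OF wfilter_wjoin[OF M(1)] _ sub, of a] M(2) by (metis mem_Collect_eq)
  qed
  from this[OF prelinear] have "x \<rightharpoonup> y \<in> M \<or> y \<rightharpoonup> x \<in> M" for x y
    by blast
  then have "prime_wfilter M"
    using M(1) by (simp add: prime_wfilter_def)
  from this M(2) show ?thesis
    by (rule that)
qed

section \<open>Strong conjunction and disjunction, and how they associate with each other\<close>

lemma wtimes_comm: "x \<boxdot> y = y \<boxdot> x"
  by (metis wtimes_def wimp_contrapos wneg_wneg)

lemma wtimes_wimp: "(x \<boxdot> y) \<rightharpoonup> z = x \<rightharpoonup> (y \<rightharpoonup> z)"
  by (metis wtimes_def wimp_contrapos wneg_wneg wimp_exchange)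

lemma wtimes_assoc: "(x \<boxdot> y) \<boxdot> z = x \<boxdot> (y \<boxdot> z)"
  by (metis wtimes_def wneg_wneg wtimes_wimp)

lemma wtimes_lcomm: "x \<boxdot> (y \<boxdot> z) = y \<boxdot> (x \<boxdot> z)"
  by (metis wtimes_assoc wtimes_comm)

lemmas wtimes_ac = wtimes_assoc wtimes_comm wtimes_lcomm

lemma wtimes_one [simp]: "x \<boxdot> 1 = x" "1 \<boxdot> x = x"
  using wneg_def wtimes_def by (simp_all flip: wneg_def)

lemma wtimes_wle: "x \<boxdot> y \<lesssim> x" "x \<boxdot> y \<lesssim> y"
  by (metis wle_def wtimes_wimp wimp_exchange wimp_one wimp_refl)+

lemma wtimes_mono: "x \<lesssim> y \<Longrightarrow> x \<boxdot> z \<lesssim> y \<boxdot> z"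
  by (simp add: wtimes_def wimp_antimono)

text \<open>Divisibility. Up to negation the left side is the join of \<open>\<sim>x\<close> and
  \<open>\<sim>y\<close>, and the hypothesis makes this join \<open>\<sim>y\<close>.\<close>

lemma wtimes_wimp_self:
  assumes "y \<lesssim> x"
  shows "x \<boxdot> (x \<rightharpoonup> y) = y"
proof -
  have "x \<boxdot> (x \<rightharpoonup> y) = \<sim>((\<sim>y \<rightharpoonup> \<sim>x) \<rightharpoonup> \<sim>x)"
    by (subst wtimes_comm) (simp add: wtimes_def wimp_contrapos)
  also have "\<dots> = \<sim>((\<sim>x \<rightharpoonup> \<sim>y) \<rightharpoonup> \<sim>y)"
    by (simp add: wimp_wimp_comm)
  also have "\<dots> = y"
    using assms by (simp add: wimp_contrapos wle_def)
  finally show ?thesis .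
qed

lemma wplus_eq: "x \<boxplus> y = \<sim>(\<sim>x \<boxdot> \<sim>y)"
  by (simp add: wplus_def wtimes_def)

lemma wtimes_eq: "x \<boxdot> y = \<sim>(\<sim>x \<boxplus> \<sim>y)"
  by (simp add: wplus_eq)

lemma wplus_comm: "x \<boxplus> y = y \<boxplus> x"
  by (simp add: wplus_eq wtimes_comm)

lemma wplus_def_comm: "x \<boxplus> y = \<sim>y \<rightharpoonup> x"
  using wplus_comm[of x y] by (simp add: wplus_def)

lemma wplus_assoc: "(x \<boxplus> y) \<boxplus> z = x \<boxplus> (y \<boxplus> z)"
  by (simp add: wplus_eq wtimes_assoc)

lemma wplus_zero [simp]: "x \<boxplus> 0 = x" "0 \<boxplus> x = x"
  by (simp_all add: wplus_eq)

lemma wle_wplus: "x \<lesssim> x \<boxplus> y" "y \<lesssim> x \<boxplus> y"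
  by (metis wplus_comm wplus_def wle_wimp)+

lemma wplus_mono: "x \<lesssim> y \<Longrightarrow> x \<boxplus> z \<lesssim> y \<boxplus> z"
  by (simp add: wplus_def wimp_antimono)

lemma wplus_wneg [simp]: "x \<boxplus> \<sim>x = 1" "\<sim>x \<boxplus> x = 1"
  by (simp_all add: wplus_def)

lemma wtimes_wneg [simp]: "x \<boxdot> \<sim>x = 0" "\<sim>x \<boxdot> x = 0"
  by (simp_all add: wtimes_eq)

lemma wplus_eq_one_iff: "x \<boxplus> y = 1 \<longleftrightarrow> \<sim>x \<lesssim> y"
  by (simp add: wplus_def wle_def)

lemma wtimes_eq_zero_iff: "x \<boxdot> y = 0 \<longleftrightarrow> x \<lesssim> \<sim>y"
  by (simp add: wtimes_def wle_def)

text \<open>Both \<open>a\<close> and \<open>c\<close> lie below \<open>?d\<close>, so divisibility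
  writes either side as the product of \<open>?d\<close>, \<open>?d \<rightharpoonup> a\<close> and
  \<open>?d \<rightharpoonup> c\<close>.\<close>

lemma wplus_wtimes_assoc:
  assumes "a \<boxdot> b = 0" "b \<boxdot> c = 0"
  shows "(a \<boxplus> b) \<boxdot> c = a \<boxdot> (b \<boxplus> c)"
proof -
  let ?d = "\<sim>b"
  have a: "a \<lesssim> ?d" and c: "c \<lesssim> ?d"
    using assms wtimes_comm[of b c] by (simp_all add: wtimes_eq_zero_iff)
  have "(a \<boxplus> b) \<boxdot> c = (?d \<rightharpoonup> a) \<boxdot> (?d \<boxdot> (?d \<rightharpoonup> c))"
    by (simp only: wtimes_wimp_self[OF c] wplus_def_comm)
  also have "\<dots> = (?d \<boxdot> (?d \<rightharpoonup> a)) \<boxdot> (?d \<rightharpoonup> c)"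
    by (simp only: wtimes_ac)
  also have "\<dots> = a \<boxdot> (b \<boxplus> c)"
    by (simp only: wtimes_wimp_self[OF a] wplus_def)
  finally show ?thesis .
qed

text \<open>The De Morgan dual of the preceding law.\<close>

lemma wtimes_wplus_assoc:
  assumes "a \<boxplus> b = 1" "b \<boxplus> c = 1"
  shows "(a \<boxdot> b) \<boxplus> c = a \<boxplus> (b \<boxdot> c)"
  using arg_cong[OF wplus_wtimes_assoc[of "\<sim>a" "\<sim>b" "\<sim>c"], of wneg] assms
  by (simp add: wtimes_eq)

text \<open>Here \<open>a\<close> lies below \<open>?d\<close> and \<open>?d\<close> below
  \<open>c\<close>. The right side is \<open>?x\<close>; as \<open>?x\<close> lies below
  \<open>c\<close>, divisibility gives \<open>?x\<close> as
  \<open>c \<boxdot> (c \<rightharpoonup> ?x)\<close>, and the second factor collapses to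
  \<open>?d \<rightharpoonup> a\<close>.\<close>

lemma wplus_wtimes_interchange:
  assumes "a \<boxdot> b = 0" "b \<boxplus> c = 1"
  shows "(a \<boxplus> b) \<boxdot> c = a \<boxplus> (b \<boxdot> c)"
proof -
  let ?d = "\<sim>b"
  let ?x = "(c \<rightharpoonup> ?d) \<rightharpoonup> a"
  have a: "a \<lesssim> ?d" and c: "?d \<lesssim> c"
    using assms by (simp_all add: wtimes_eq_zero_iff wplus_eq_one_iff)
  have "?x \<lesssim> c"
  proof -
    have "?x \<lesssim> (c \<rightharpoonup> ?d) \<rightharpoonup> ?d"
      by (intro wimp_mono a)
    also have "(c \<rightharpoonup> ?d) \<rightharpoonup> ?d = c"
      using c by (metis one_wimp wimp_wimp_comm wle_def)
    finally show ?thesis .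
  qed
  have "a \<boxplus> (b \<boxdot> c) = ?x"
    by (subst wtimes_comm) (simp add: wplus_def_comm wtimes_def)
  also have "\<dots> = c \<boxdot> (c \<rightharpoonup> ?x)"
    by (rule wtimes_wimp_self[OF \<open>?x \<lesssim> c\<close>, symmetric])
  also have "c \<rightharpoonup> ?x = ?d \<rightharpoonup> a"
    by (simp only: wtimes_wimp_self[OF c] flip: wtimes_wimp)
  also have "c \<boxdot> (?d \<rightharpoonup> a) = (a \<boxplus> b) \<boxdot> c"
    by (subst wtimes_comm) (simp only: wplus_def_comm)
  finally show ?thesis ..
qed

lemma wtimes_neq_one: "a \<noteq> 1 \<Longrightarrow> a \<boxdot> b \<noteq> 1"
  using wtimes_wle(1)[of a b] by (metis one_wle_iff)

lemma wplus_one [simp]: "a \<boxplus> 1 = 1" "1 \<boxplus> a = 1"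
  by (simp_all add: wplus_def)

lemma wtimes_mono_right: "x \<lesssim> y \<Longrightarrow> z \<boxdot> x \<lesssim> z \<boxdot> y"
  using wtimes_mono by (simp add: wtimes_comm)

lemma wplus_mono_right: "x \<lesssim> y \<Longrightarrow> z \<boxplus> x \<lesssim> z \<boxplus> y"
  using wplus_mono by (simp add: wplus_comm)

lemma wplus_eq_one_mono: "x \<lesssim> y \<Longrightarrow> z \<boxplus> x = 1 \<Longrightarrow> z \<boxplus> y = 1"
  using wplus_mono_right by (metis one_wle_iff)

lemma wtimes_wle_wplus: "a \<boxdot> b \<lesssim> a \<boxplus> c"
  using wtimes_wle(1) wle_wplus(1) by (rule wle_trans)

end

section \<open>The Chang group of a chain\<close>

class wajsberg_chain = wajsberg +
  assumes wimp_total: "x \<rightharpoonup> y = 1 \<or> y \<rightharpoonup> x = 1"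
    and zero_neq_one_wajsberg: "0 \<noteq> 1"
begin

lemma wle_total: "x \<lesssim> y \<or> y \<lesssim> x"
  using wimp_total by (simp add: wle_def)

text \<open>Totality enters here: either the sum reaches 1 or \<open>x\<close> lies below
  \<open>\<sim>y\<close>.\<close>

lemma wtimes_eq_zero:
  assumes "x \<boxplus> y \<noteq> 1"
  shows "x \<boxdot> y = 0"
  using assms wle_total[of "\<sim>x" y] wtimes_comm[of x y]
  by (auto simp: wplus_eq_one_iff wtimes_eq_zero_iff)

text \<open>\<open>(m, a)\<close> stands for \<open>m + a\<close> with \<open>0 \<le> a < 1\<close>; as \<open>a + b = (a \<boxplus> b) + (a \<boxdot> b)\<close>, a sum
  \<open>a \<boxplus> b = 1\<close> is a carry and leaves \<open>a \<boxdot> b\<close>.\<close>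

fun cplus :: "int \<times> 'a \<Rightarrow> int \<times> 'a \<Rightarrow> int \<times> 'a" where
  "cplus (m, a) (n, b) = (if a \<boxplus> b = 1 then (m + n + 1, a \<boxdot> b) else (m + n, a \<boxplus> b))"

text \<open>The cases record which inner sums carry; each is settled by one of the associativity
  laws. In the mixed cases each side carries exactly once, since a product with a factor other than
  1 is not 1.\<close>

lemma cplus_assoc:
  assumes "a \<noteq> 1" "b \<noteq> 1" "c \<noteq> 1"
  shows "cplus (cplus (m, a) (n, b)) (k, c) = cplus (m, a) (cplus (n, b) (k, c))"
proof (cases "a \<boxplus> b = 1"; cases "b \<boxplus> c = 1")
  assume "a \<boxplus> b \<noteq> 1" "b \<boxplus> c \<noteq> 1"
  then show ?thesis
    using wplus_wtimes_assoc[OF wtimes_eq_zero wtimes_eq_zero, of a b c]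
    by (simp add: wplus_assoc)
next
  assume *: "a \<boxplus> b \<noteq> 1" "b \<boxplus> c = 1"
  have "(a \<boxplus> b) \<boxdot> c = a \<boxplus> (b \<boxdot> c)"
    using * by (intro wplus_wtimes_interchange wtimes_eq_zero)
  moreover have "(a \<boxplus> b) \<boxdot> c \<noteq> 1"
    using * by (simp add: wtimes_neq_one)
  ultimately show ?thesis
    using * by (simp add: wplus_assoc)
next
  assume *: "a \<boxplus> b = 1" "b \<boxplus> c \<noteq> 1"
  have "(c \<boxplus> b) \<boxdot> a = c \<boxplus> (b \<boxdot> a)"
    using * by (intro wplus_wtimes_interchange wtimes_eq_zero) (simp_all add: wplus_comm)
  then have eq: "(a \<boxdot> b) \<boxplus> c = a \<boxdot> (b \<boxplus> c)"
    by (metis wplus_comm wtimes_comm)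
  moreover have "a \<boxdot> (b \<boxplus> c) \<noteq> 1"
    using assms by (simp add: wtimes_neq_one)
  moreover have "a \<boxplus> (b \<boxplus> c) = 1"
    using * by (simp flip: wplus_assoc)
  ultimately show ?thesis
    using * by simp
next
  assume "a \<boxplus> b = 1" "b \<boxplus> c = 1"
  then show ?thesis
    using wtimes_wplus_assoc[of a b c] by (simp add: wtimes_assoc)
qed

fun cle :: "int \<times> 'a \<Rightarrow> int \<times> 'a \<Rightarrow> bool" where
  "cle (m, a) (n, b) \<longleftrightarrow> m < n \<or> m = n \<and> a \<lesssim> b"

lemma cle_trans: "cle p q \<Longrightarrow> cle q r \<Longrightarrow> cle p r"
  using wle_trans by (cases p; cases q; cases r) fastforce

lemma cle_total: "cle p q \<or> cle q p"
  using wle_total by (cases p; cases q) auto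

lemma cle_cplus_mono:
  assumes "cle p q"
  shows "cle (cplus r p) (cplus r q)"
proof -
  obtain m a n b k c where eq: "p = (m, a)" "q = (n, b)" "r = (k, c)"
    by (metis surj_pair)
  from assms consider "m < n" | "m = n" "a \<lesssim> b"
    by (auto simp: eq)
  then show ?thesis
  proof cases
    case 1
    then show ?thesis
      \<comment> \<open>If only the sum with the smaller integer part carries, the integer parts may
        become equal; then the digits \<open>c \<boxdot> a\<close> and \<open>c \<boxplus> b\<close>
        decide.\<close>
      using wtimes_wle_wplus[of c a b] by (auto simp: eq)
  next
    case 2
    then show ?thesis
      using wtimes_mono_right[of a b c] wplus_mono_right[of a b c] wplus_eq_one_mono[of a b c]
      by (auto simp: eq)
  qed
qed

end

typedef (overloaded) 'a chang = "{(m, a). a \<noteq> 1} :: (int \<times> 'a::wajsberg_chain) set"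
  using zero_neq_one_wajsberg by auto

setup_lifting type_definition_chang

instantiation chang :: (wajsberg_chain) linordered_ab_group_add
begin

lift_definition zero_chang :: "'a chang" is "(0, 0)"
  by (simp add: zero_neq_one_wajsberg)

lift_definition plus_chang :: "'a chang \<Rightarrow> 'a chang \<Rightarrow> 'a chang" is cplus
  by (auto simp: wtimes_neq_one split: if_splits)

text \<open>-(m + a) = (-m - 1) + (1 - a); the digit 0 is separate because its complement 1 is not a
  digit.\<close>

lift_definition uminus_chang :: "'a chang \<Rightarrow> 'a chang" is
  "\<lambda>(m, a). if a = 0 then (- m, 0) else (- m - 1, \<sim>a)"
  by (auto simp: zero_neq_one_wajsberg split: if_splits)

definition minus_chang :: "'a chang \<Rightarrow> 'a chang \<Rightarrow> 'a chang" where
  "minus_chang x y = x + - y"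

lift_definition less_eq_chang :: "'a chang \<Rightarrow> 'a chang \<Rightarrow> bool" is cle .

definition less_chang :: "'a chang \<Rightarrow> 'a chang \<Rightarrow> bool" where
  "less_chang x y \<longleftrightarrow> x \<le> y \<and> \<not> y \<le> x"

instance
proof
  fix x y z :: "'a chang"
  show "x + y + z = x + (y + z)"
    by transfer (auto simp del: cplus.simps intro: cplus_assoc)
  show "x + y = y + x"
    by transfer (auto simp: wplus_comm wtimes_comm)
  show "0 + x = x"
    by transfer auto
  show "- x + x = 0"
    by transfer auto
  show "x - y = x + - y"
    by (rule minus_chang_def)
  show "x < y \<longleftrightarrow> x \<le> y \<and> \<not> y \<le> x"
    by (rule less_chang_def)
  show "x \<le> x"
    by transfer auto
  show "x \<le> y \<Longrightarrow> y \<le> z \<Longrightarrow> x \<le> z"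
    by transfer (auto simp del: cle.simps intro: cle_trans)
  show "x \<le> y \<Longrightarrow> y \<le> x \<Longrightarrow> x = y"
    by transfer (auto intro: wle_antisym)
  show "x \<le> y \<or> y \<le> x"
    by transfer (rule cle_total)
  show "x \<le> y \<Longrightarrow> z + x \<le> z + y"
    by transfer (auto simp del: cplus.simps cle.simps intro: cle_cplus_mono)
qed

end

text \<open>The chain is placed just below \<open>0\<close>, so that the designated value \<open>1\<close> becomes \<open>0\<close>.\<close>

lift_definition unit_interval :: "'a::wajsberg_chain \<Rightarrow> 'a chang" is
  "\<lambda>a. if a = 1 then (0, 0) else (- 1, a)"
  by (simp add: zero_neq_one_wajsberg)

lemma unit_interval_one [simp]: "unit_interval 1 = 0"
  by transfer simp

lemma unit_interval_eq_zero_iff [simp]: "unit_interval a = 0 \<longleftrightarrow> a = 1"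
  by transfer simp

lemma unit_interval_mono: "a \<lesssim> b \<Longrightarrow> unit_interval a \<le> unit_interval b"
  by transfer (auto dest: wle_antisym)

lemma unit_interval_le_zero: "unit_interval a \<le> 0"
  using unit_interval_mono[of a 1] by simp

text \<open>Away from the value 1 both summands have integer part -1. Their digits add up to 1, so a
  carry brings the integer part back to -1 and leaves the digit
  \<open>(a \<rightharpoonup> b) \<boxdot> a\<close>, which is \<open>b\<close>.\<close>

lemma unit_interval_wimp_add:
  assumes "b \<lesssim> a"
  shows "unit_interval (a \<rightharpoonup> b) + unit_interval a = unit_interval b"
proof -
  have plus: "(a \<rightharpoonup> b) \<boxplus> a = 1"
    using wtimes_wimp[of a "\<sim>a" b] by (simp add: wplus_def_comm wimp_exchange[of "\<sim>a"])
  have times: "(a \<rightharpoonup> b) \<boxdot> a = b"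
    using assms by (simp add: wtimes_comm[of _ a] wtimes_wimp_self)
  show ?thesis
  proof (cases "a = 1 \<or> a \<rightharpoonup> b = 1")
    case True
    then have "a = 1 \<or> a = b"
      using assms wle_antisym by (auto simp: wle_def)
    then show ?thesis by auto
  next
    case False
    then have "a \<noteq> 1" "a \<rightharpoonup> b \<noteq> 1" "b \<noteq> 1"
      using assms by auto
    then show ?thesis
      using plus times by transfer simp
  qed
qed

lemma min_zero_unit_interval_diff:
  "min 0 (unit_interval b - unit_interval a) = unit_interval (a \<rightharpoonup> b)"
proof (cases "a \<lesssim> b")
  case True
  then show ?thesis
    using unit_interval_mono[OF True] by (simp add: wle_def)
next
  case False
  then have "unit_interval (a \<rightharpoonup> b) = unit_interval b - unit_interval a"
    using unit_interval_wimp_add[of b a] wle_total[of a b] by (simp add: eq_diff_eq)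
  then show ?thesis
    using unit_interval_le_zero[of "a \<rightharpoonup> b"] by simp
qed

section \<open>The Lindenbaum algebra and its prime quotient\<close>

lemma luk_trans: "luk (A \<^bold>\<supset> B) \<Longrightarrow> luk (B \<^bold>\<supset> C) \<Longrightarrow> luk (A \<^bold>\<supset> C)"
  using luk.L2 luk.MP by blast

text \<open>The middle formula is (B \<supset> A) \<supset> A: L1 reaches it, and L3 swaps the roles
  of \<open>A\<close> and \<open>B\<close>.\<close>

lemma luk_assertion: "luk (A \<^bold>\<supset> (A \<^bold>\<supset> B) \<^bold>\<supset> B)"
  using luk_trans[OF luk.L1 luk.L3] .

lemma luk_exchange:
  assumes "luk (A \<^bold>\<supset> B \<^bold>\<supset> C)"
  shows "luk (B \<^bold>\<supset> A \<^bold>\<supset> C)"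
  using luk_trans[OF luk_assertion luk.MP[OF luk.L2 assms]] .

lemma luk_refl: "luk (A \<^bold>\<supset> A)"
  using luk.MP[OF luk_exchange[OF luk.L1] luk.L1] .

lemma luk_weaken: "luk A \<Longrightarrow> luk (B \<^bold>\<supset> A)"
  using luk.L1 luk.MP by blast

lemma luk_imp_cong:
  assumes "luk (A' \<^bold>\<supset> A)" "luk (B \<^bold>\<supset> B')"
  shows "luk ((A \<^bold>\<supset> B) \<^bold>\<supset> (A' \<^bold>\<supset> B'))"
  using luk_trans[OF luk.MP[OF luk.L2 assms(1)] luk.MP[OF luk_exchange[OF luk.L2] assms(2)]] .

section \<open>The Lindenbaum algebra\<close>

definition luk_equiv :: "mform \<Rightarrow> mform \<Rightarrow> bool" where
  "luk_equiv A B \<longleftrightarrow> luk (A \<^bold>\<supset> B) \<and> luk (B \<^bold>\<supset> A)"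

quotient_type lind = mform / luk_equiv
proof (rule equivpI)
  show "reflp luk_equiv"
    by (simp add: reflp_def luk_equiv_def luk_refl)
  show "symp luk_equiv"
    by (simp add: symp_def luk_equiv_def)
  show "transp luk_equiv"
    unfolding transp_def luk_equiv_def using luk_trans by blast
qed

instantiation lind :: wajsberg
begin

lift_definition zero_lind :: lind is Bot .

lift_definition one_lind :: lind is "Bot \<^bold>\<supset> Bot" .

lift_definition wimp_lind :: "lind \<Rightarrow> lind \<Rightarrow> lind" is Imp
  by (simp add: luk_equiv_def luk_imp_cong)

lemma luk_equiv_one_iff: "luk_equiv A (Bot \<^bold>\<supset> Bot) \<longleftrightarrow> luk A"
  unfolding luk_equiv_def
  using luk.MP luk_refl luk_weaken by blast

instance
proof
  fix x y z :: lind
  show "1 \<rightharpoonup> x = x"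
  proof transfer
    fix A
    show "luk_equiv ((Bot \<^bold>\<supset> Bot) \<^bold>\<supset> A) A"
      using luk.MP[OF luk_assertion luk_refl] luk.L1 by (simp add: luk_equiv_def)
  qed
  show "(x \<rightharpoonup> y) \<rightharpoonup> ((y \<rightharpoonup> z) \<rightharpoonup> (x \<rightharpoonup> z)) = 1"
    by transfer (simp add: luk_equiv_one_iff luk.L2)
  show "(x \<rightharpoonup> y) \<rightharpoonup> y = (y \<rightharpoonup> x) \<rightharpoonup> x"
    by transfer (simp add: luk_equiv_def luk.L3)
  show "((x \<rightharpoonup> 0) \<rightharpoonup> (y \<rightharpoonup> 0)) \<rightharpoonup> (y \<rightharpoonup> x) = 1"
    by transfer (simp add: luk_equiv_one_iff luk.L4)
qed

end

lemma abs_lind_eq_one_iff: "abs_lind A = 1 \<longleftrightarrow> luk A"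
  by (simp add: one_lind_def lind.abs_eq_iff luk_equiv_one_iff)

text \<open>A type cannot depend on a variable, so the formula to be refuted is fixed here, once and
  for all: an arbitrary counterexample to the completeness of Lukasiewicz logic, if there is one.\<close>

definition bad_formula :: mform where
  "bad_formula = (SOME A. \<not> luk A \<and>
    ((\<exists>B. \<not> luk B \<and> B \<in> material_fragment TYPE(nat)) \<longrightarrow> A \<in> material_fragment TYPE(nat)))"

lemma bad_formula:
  shows not_luk_bad_formula: "\<not> luk bad_formula"
    and bad_formula_material:
      "\<not> luk B \<Longrightarrow> B \<in> material_fragment TYPE(nat) \<Longrightarrow> bad_formula \<in> material_fragment TYPE(nat)"
proof -
  \<comment> \<open>The choice needs an underivable formula even when there is no counterexample;
    \<bottom> is one.\<close>
  have "\<not> luk Bot"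
    using luk_compound[of Bot] by auto
  then have "\<exists>A. \<not> luk A \<and>
      ((\<exists>B. \<not> luk B \<and> B \<in> material_fragment TYPE(nat)) \<longrightarrow> A \<in> material_fragment TYPE(nat))"
    by blast
  from someI_ex[OF this, folded bad_formula_def]
  show "\<not> luk bad_formula"
    and "\<not> luk B \<Longrightarrow> B \<in> material_fragment TYPE(nat) \<Longrightarrow> bad_formula \<in> material_fragment TYPE(nat)"
    by blast+
qed

section \<open>The prime filter omitting the fixed formula, and its quotient chain\<close>

definition bad_filter :: "lind set" where
  "bad_filter = (SOME F. prime_wfilter F \<and> abs_lind bad_formula \<notin> F)"

lemma bad_filter:
  shows prime_bad_filter: "prime_wfilter bad_filter"
    and bad_formula_notin: "abs_lind bad_formula \<notin> bad_filter"
proof -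
  have "\<exists>F. prime_wfilter F \<and> abs_lind bad_formula \<notin> F"
    using prime_wfilter_exists[of "abs_lind bad_formula"] not_luk_bad_formula
    by (auto simp: abs_lind_eq_one_iff)
  from someI_ex[OF this, folded bad_filter_def]
  show "prime_wfilter bad_filter" "abs_lind bad_formula \<notin> bad_filter"
    by blast+
qed

lemma wfilter_bad_filter: "wfilter bad_filter"
  using prime_bad_filter by (simp add: prime_wfilter_def)

lemma one_bad_filter [simp]: "1 \<in> bad_filter"
  using wfilter_bad_filter by (rule wfilter_one)

lemma bad_filter_trans:
  assumes "x \<rightharpoonup> y \<in> bad_filter" "y \<rightharpoonup> z \<in> bad_filter"
  shows "x \<rightharpoonup> z \<in> bad_filter"
proof -
  have "(x \<rightharpoonup> y) \<rightharpoonup> (y \<rightharpoonup> z) \<rightharpoonup> (x \<rightharpoonup> z) \<in> bad_filter"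
    by (simp add: wimp_trans_one)
  then show ?thesis
    using wfilter_mp[OF wfilter_bad_filter] assms by blast
qed

definition bad_equiv :: "lind \<Rightarrow> lind \<Rightarrow> bool" where
  "bad_equiv x y \<longleftrightarrow> x \<rightharpoonup> y \<in> bad_filter \<and> y \<rightharpoonup> x \<in> bad_filter"

quotient_type bad_chain = lind / bad_equiv
proof (rule equivpI)
  show "reflp bad_equiv"
    by (simp add: reflp_def bad_equiv_def)
  show "symp bad_equiv"
    by (simp add: symp_def bad_equiv_def)
  show "transp bad_equiv"
    unfolding transp_def bad_equiv_def using bad_filter_trans by blast
qed

lemma bad_filter_wimp_cong:
  assumes "x' \<rightharpoonup> x \<in> bad_filter" "y \<rightharpoonup> y' \<in> bad_filter"
  shows "(x \<rightharpoonup> y) \<rightharpoonup> (x' \<rightharpoonup> y') \<in> bad_filter"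
proof (rule bad_filter_trans)
  have "(x' \<rightharpoonup> x) \<lesssim> (x \<rightharpoonup> y) \<rightharpoonup> (x' \<rightharpoonup> y)"
    by (simp add: wle_def wimp_trans_one)
  then show "(x \<rightharpoonup> y) \<rightharpoonup> (x' \<rightharpoonup> y) \<in> bad_filter"
    using wfilter_up[OF wfilter_bad_filter assms(1)] by blast
  have "(y \<rightharpoonup> y') \<lesssim> (x' \<rightharpoonup> y) \<rightharpoonup> (x' \<rightharpoonup> y')"
    by (subst wle_wimp_swap) (simp add: wle_def wimp_trans_one)
  then show "(x' \<rightharpoonup> y) \<rightharpoonup> (x' \<rightharpoonup> y') \<in> bad_filter"
    using wfilter_up[OF wfilter_bad_filter assms(2)] by blast
qed

lemma bad_equiv_one_iff: "bad_equiv x 1 \<longleftrightarrow> x \<in> bad_filter"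
  by (simp add: bad_equiv_def)

lemma bad_equiv_refl: "bad_equiv x x"
  by (simp add: bad_equiv_def)

instantiation bad_chain :: wajsberg_chain
begin

lift_definition zero_bad_chain :: bad_chain is 0 .

lift_definition one_bad_chain :: bad_chain is 1 .

lift_definition wimp_bad_chain :: "bad_chain \<Rightarrow> bad_chain \<Rightarrow> bad_chain" is wimp
  by (simp add: bad_equiv_def bad_filter_wimp_cong)

instance
proof
  fix x y z :: bad_chain
  show "1 \<rightharpoonup> x = x"
    by transfer (simp add: bad_equiv_refl)
  show "(x \<rightharpoonup> y) \<rightharpoonup> ((y \<rightharpoonup> z) \<rightharpoonup> (x \<rightharpoonup> z)) = 1"
    by transfer (simp add: wimp_trans_one bad_equiv_refl)
  show "(x \<rightharpoonup> y) \<rightharpoonup> y = (y \<rightharpoonup> x) \<rightharpoonup> x"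
    by transfer (simp add: wimp_wimp_comm bad_equiv_refl)
  show "((x \<rightharpoonup> 0) \<rightharpoonup> (y \<rightharpoonup> 0)) \<rightharpoonup> (y \<rightharpoonup> x) = 1"
    by transfer (simp add: wimp_contrapos_one bad_equiv_refl)
next
  show "(0::bad_chain) \<noteq> 1"
  proof transfer
    have "0 \<notin> bad_filter"
      using bad_formula_notin wfilter_up[OF wfilter_bad_filter _ zero_wle] by blast
    then show "\<not> bad_equiv 0 1"
      by (simp add: bad_equiv_one_iff)
  qed
next
  fix x y :: bad_chain
  show "x \<rightharpoonup> y = 1 \<or> y \<rightharpoonup> x = 1"
    using prime_bad_filter unfolding prime_wfilter_def
    by transfer (simp add: bad_equiv_one_iff)
qed

end

section \<open>Transfer between l-groups and completeness\<close>

definition transport :: "('a \<Rightarrow> 'b) \<Rightarrow> 'a lgroup \<Rightarrow> 'b lgroup" where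
  "transport f G =
    \<lparr>carrier = f ` carrier G,
     mult = \<lambda>x y. f (inv_into UNIV f x \<otimes>\<^bsub>G\<^esub> inv_into UNIV f y),
     one = f \<one>\<^bsub>G\<^esub>,
     ljoin = \<lambda>x y. f (inv_into UNIV f x \<curlyvee>\<^bsub>G\<^esub> inv_into UNIV f y)\<rparr>"

context
  fixes f :: "'a \<Rightarrow> 'b" and G :: "'a lgroup"
  assumes f: "inj f" and G: "abelian_lgroup G"
begin

interpretation G: abelian_lgroup G
  by (rule G)

lemma transport_simps [simp]:
  "carrier (transport f G) = f ` carrier G"
  "f x \<otimes>\<^bsub>transport f G\<^esub> f y = f (x \<otimes>\<^bsub>G\<^esub> y)"
  "\<one>\<^bsub>transport f G\<^esub> = f \<one>\<^bsub>G\<^esub>"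
  "f x \<curlyvee>\<^bsub>transport f G\<^esub> f y = f (x \<curlyvee>\<^bsub>G\<^esub> y)"
  by (simp_all add: transport_def f)

lemma comm_group_transport: "comm_group (transport f G)"
proof (rule comm_groupI)
  fix x assume "x \<in> carrier (transport f G)"
  then obtain a where "a \<in> carrier G" "x = f a"
    by auto
  then show "\<exists>y\<in>carrier (transport f G). y \<otimes>\<^bsub>transport f G\<^esub> x = \<one>\<^bsub>transport f G\<^esub>"
    by (intro bexI[of _ "f (inv\<^bsub>G\<^esub> a)"]) auto
qed (auto simp: G.m_ac)

lemma abelian_lgroup_transport: "abelian_lgroup (transport f G)"
proof -
  interpret T: comm_group "transport f G"
    by (rule comm_group_transport)
  show ?thesis
    by unfold_locales
      (auto simp: G.join_assoc G.join_idem G.mult_join_distrib intro: arg_cong[OF G.join_comm])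
qed

lemma inv_transport:
  assumes "a \<in> carrier G"
  shows "inv\<^bsub>transport f G\<^esub> (f a) = f (inv\<^bsub>G\<^esub> a)"
proof -
  interpret T: comm_group "transport f G"
    by (rule comm_group_transport)
  show ?thesis
    using assms by (intro T.inv_equality) auto
qed

lemma aeval_transport:
  assumes "range v \<subseteq> carrier G"
  shows "aeval (transport f G) (f \<circ> v) A = f (aeval G v A) \<and> aeval G v A \<in> carrier G"
proof -
  have "v p \<in> carrier G" for p
    using assms by blast
  then show ?thesis
    by (induction A) (auto simp: inv_transport lmeet_def)
qed

lemma lle_transport: "f x \<preceq>\<^bsub>transport f G\<^esub> f y \<longleftrightarrow> x \<preceq>\<^bsub>G\<^esub> y"
  by (simp add: lle_def inj_eq[OF f])

end

text \<open>The inclusion is contravariant: every l-group over \<open>'a\<close> has an isomorphic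
  copy over \<open>'b\<close>, so a countermodel over \<open>'a\<close> yields one over
  \<open>'b\<close>.\<close>

lemma abelian_theorems_inj:
  fixes f :: "'a \<Rightarrow> 'b"
  assumes "inj f"
  shows "abelian_theorems TYPE('b) \<subseteq> abelian_theorems TYPE('a)"
proof
  fix A :: "'p aform"
  assume A: "A \<in> abelian_theorems TYPE('b)"
  have "\<one>\<^bsub>G\<^esub> \<preceq>\<^bsub>G\<^esub> aeval G v A"
    if G: "abelian_lgroup G" and v: "range v \<subseteq> carrier G" for G :: "'a lgroup" and v
  proof -
    have "range (f \<circ> v) \<subseteq> carrier (transport f G)"
      using v assms G by auto
    then have "\<one>\<^bsub>transport f G\<^esub> \<preceq>\<^bsub>transport f G\<^esub> aeval (transport f G) (f \<circ> v) A"
      using A abelian_lgroup_transport[OF assms G] unfolding abelian_theorems_def by blast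
    then show ?thesis
      using aeval_transport[OF assms G v, of A] lle_transport[OF assms G]
      by (simp add: transport_simps[OF assms G])
  qed
  then show "A \<in> abelian_theorems TYPE('a)"
    by (simp add: abelian_theorems_def)
qed

lemma material_fragment_inj:
  fixes f :: "'a \<Rightarrow> 'b"
  assumes "inj f"
  shows "material_fragment TYPE('b) \<subseteq> material_fragment TYPE('a)"
  using abelian_theorems_inj[OF assms] by (auto simp: material_fragment_def)

section \<open>Linearly ordered groups as l-groups\<close>

definition additive_lgroup :: "'a::linordered_ab_group_add lgroup" where
  "additive_lgroup = \<lparr>carrier = UNIV, mult = (+), one = 0, ljoin = max\<rparr>"

lemma additive_lgroup_simps [simp]:
  "carrier additive_lgroup = UNIV"
  "x \<otimes>\<^bsub>additive_lgroup\<^esub> y = x + y"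
  "\<one>\<^bsub>additive_lgroup\<^esub> = 0"
  "x \<curlyvee>\<^bsub>additive_lgroup\<^esub> y = max x y"
  by (simp_all add: additive_lgroup_def)

lemma comm_group_additive_lgroup: "comm_group additive_lgroup"
proof (rule comm_groupI)
  fix x :: 'a
  show "\<exists>y\<in>carrier additive_lgroup. y \<otimes>\<^bsub>additive_lgroup\<^esub> x = \<one>\<^bsub>additive_lgroup\<^esub>"
    by (intro bexI[of _ "- x"]) auto
qed (auto simp: add_ac)

lemma inv_additive_lgroup [simp]: "inv\<^bsub>additive_lgroup\<^esub> x = - x"
proof -
  interpret comm_group "additive_lgroup :: 'a lgroup"
    by (rule comm_group_additive_lgroup)
  show ?thesis
    by (intro inv_equality) auto
qed

lemma lmeet_additive_lgroup [simp]: "x \<curlywedge>\<^bsub>additive_lgroup\<^esub> y = min x y"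
  by (simp add: lmeet_def minus_max_eq_min)

lemma lle_additive_lgroup [simp]: "x \<preceq>\<^bsub>additive_lgroup\<^esub> y \<longleftrightarrow> x \<le> y"
  by (auto simp: lle_def max_def)

lemma abelian_lgroup_additive_lgroup: "abelian_lgroup additive_lgroup"
proof -
  interpret comm_group "additive_lgroup :: 'a lgroup"
    by (rule comm_group_additive_lgroup)
  show ?thesis
    by unfold_locales (auto simp: max.assoc max.commute max.left_commute max_add_distrib_right)
qed

text \<open>Abelian logic does not truncate implications from above, so the value of a formula in the
  Chang group agrees with its value in the chain only after taking the meet with \<open>0\<close>.\<close>

lemma aeval_unit_interval:
  fixes h :: "mform \<Rightarrow> 'a::wajsberg_chain"
  assumes h_Bot: "h Bot = 0" and h_Imp: "\<And>A B. h (A \<^bold>\<supset> B) = h A \<rightharpoonup> h B"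
    and v: "v = case_option (unit_interval 0) (\<lambda>n. unit_interval (h (Prop n)))"
  shows "unit_interval 0 \<le> aeval additive_lgroup v (material A) \<and>
    min 0 (aeval additive_lgroup v (material A)) = unit_interval (h A)"
proof (induction A)
  case (Prop n)
  then show ?case
    by (simp add: v unit_interval_mono unit_interval_le_zero min_absorb2)
next
  case Bot
  then show ?case
    by (simp add: v h_Bot unit_interval_le_zero min_absorb2)
next
  case (Imp A B)
  let ?a = "unit_interval (h A)" and ?y = "aeval additive_lgroup v (material B)"
  \<comment> \<open>The meet with t is \<open>?a\<close> by induction, and the join with \<bottom>
    is absorbed because \<bottom> lies below \<open>?y\<close>; this is why the lower bound is part
    of the induction.\<close>
  have val: "aeval additive_lgroup v (material (A \<^bold>\<supset> B)) = ?y - ?a"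
    using Imp.IH by (simp add: v max_absorb2)
  have a: "?a \<le> 0"
    by (rule unit_interval_le_zero)
  have "?y \<le> ?y - ?a"
    using a by simp
  then have "unit_interval 0 \<le> ?y - ?a"
    using Imp.IH(2) by (meson order_trans)
  \<comment> \<open>Cutting \<open>?y\<close> off at 0 first is harmless: for positive
    \<open>?y\<close> both sides are 0, as \<open>?a\<close> is at most 0.\<close>
  moreover have "min 0 (?y - ?a) = min 0 (min 0 ?y - ?a)"
    using a by (auto simp: min_def)
  ultimately show ?case
    using Imp.IH(2) by (simp only: val h_Imp min_zero_unit_interval_diff)
qed

lemma material_fragment_chang:
  fixes h :: "mform \<Rightarrow> 'a::wajsberg_chain"
  assumes "h Bot = 0" "\<And>A B. h (A \<^bold>\<supset> B) = h A \<rightharpoonup> h B"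
    and "A \<in> material_fragment TYPE('a chang)"
  shows "h A = 1"
proof -
  define v where "v = case_option (unit_interval 0) (\<lambda>n. unit_interval (h (Prop n)))"
  have "0 \<le> aeval additive_lgroup v (material A)"
    using assms(3) abelian_lgroup_additive_lgroup
    unfolding material_fragment_def abelian_theorems_def by fastforce
  then have "unit_interval (h A) = 0"
    using aeval_unit_interval[OF assms(1,2) v_def, of A] by (simp add: min_absorb1)
  then show ?thesis by simp
qed

section \<open>Refutation in the countable Chang group of the quotient chain\<close>

definition bad_class :: "mform \<Rightarrow> bad_chain" where
  "bad_class A = abs_bad_chain (abs_lind A)"

lemma bad_class_Bot: "bad_class Bot = 0"
  by (simp add: bad_class_def zero_bad_chain_def zero_lind_def)

lemma bad_class_Imp: "bad_class (A \<^bold>\<supset> B) = bad_class A \<rightharpoonup> bad_class B"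
  by (simp add: bad_class_def wimp_bad_chain.abs_eq wimp_lind.abs_eq)

lemma bad_class_bad_formula: "bad_class bad_formula \<noteq> 1"
  using bad_formula_notin
  by (simp add: bad_class_def one_bad_chain_def bad_chain.abs_eq_iff bad_equiv_one_iff)

lemma surj_bad_class: "surj bad_class"
proof -
  have "surj abs_lind" "surj abs_bad_chain"
    using Quotient_abs_rep[OF Quotient_lind] Quotient_abs_rep[OF Quotient_bad_chain]
    by (metis surjI)+
  then show ?thesis
    using comp_surj[of abs_lind abs_bad_chain] by (simp add: bad_class_def[abs_def] comp_def)
qed

instance mform :: countable
  by countable_datatype

text \<open>An element is an integer with a digit, and each digit is coded by a formula chosen from
  its class.\<close>

lemma bad_chang_countable: "\<exists>f :: bad_chain chang \<Rightarrow> nat. inj f"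
proof -
  have "inj (inv_into UNIV bad_class)"
    by (rule surj_imp_inj_inv[OF surj_bad_class])
  then have "inj (\<lambda>x. to_nat (map_prod id (inv_into UNIV bad_class) (Rep_chang x)))"
    by (auto simp: inj_on_def[of to_nat] inj_eq prod_eq_iff intro!: injI iffD1[OF Rep_chang_inject])
  then show ?thesis by blast
qed

text \<open>\<open>bad_formula\<close> is chosen with respect to \<open>nat\<close> alone, so
  completeness is proved there first and reaches any infinite type by an injection.\<close>

lemma material_fragment_nat_luk:
  assumes "A \<in> material_fragment TYPE(nat)"
  shows "luk A"
proof (rule ccontr)
  assume "\<not> luk A"
  then have "bad_formula \<in> material_fragment TYPE(nat)"
    using assms by (rule bad_formula_material)
  then have "bad_formula \<in> material_fragment TYPE(bad_chain chang)"
    using bad_chang_countable material_fragment_inj by blast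
  then show False
    using material_fragment_chang[OF bad_class_Bot bad_class_Imp] bad_class_bad_formula by blast
qed

theorem mainTheorem1:
  fixes \<phi> :: mform
  assumes "infinite (UNIV :: 'g set)"
  shows "\<phi> \<in> Luk \<longleftrightarrow> \<phi> \<in> material_fragment TYPE('g)"
proof
  assume "\<phi> \<in> Luk"
  then show "\<phi> \<in> material_fragment TYPE('g)"
    using abelian_lgroup.luk_sound
    by (auto simp: Luk_def material_fragment_def abelian_theorems_def)
next
  assume "\<phi> \<in> material_fragment TYPE('g)"
  moreover obtain f :: "nat \<Rightarrow> 'g" where "inj f"
    using assms infinite_countable_subset by blast
  ultimately show "\<phi> \<in> Luk"
    using material_fragment_inj material_fragment_nat_luk by (auto simp: Luk_def)
qed

end
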